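(* Let $X,Y$ be two weakly locally convex sober topological cones, and let $\alpha\colon\mathcal V_{\mathrm p}X\to X$ and $\beta\colon\mathcal V_{\mathrm p}Y\to Y$ be the structure maps of the corresponding $\mathcal V_{\mathrm p}$-algebras, i.e. the unique continuous linear maps with $\alpha(\delta_x)=x$ for all $x\in X$ and $\beta(\delta_y)=y$ for all $y\in Y$. Then a continuous map $f\colon X\to Y$ is a $\mathcal V_{\mathrm p}$-algebra morphism (from $(X,\alpha)$ to $(Y,\beta)$) if and only if $f$ is linear.
   Context: $\mathbb R_+=[0,\infty)$ and $\overline{\mathbb R}_+=[0,\infty]$, both with the Scott topology (proper nonempty opens are the sets of elements $>r$, $r\in\mathbb R_+$). Valuations. A valuation on a space $X$ with lattice of opens $\mathcal OX$ is a map $\mu\colon\mathcal OX\to\overline{\mathbb R}_+$ with $\mu(\emptyset)=0$, $\mu(U)\le\mu(V)$ if $U\subseteq V$, and $\mu(U)+\mu(V)=\mu(U\cup V)+\mu(U\cap V)$. The point topology on $\mathcal OX$ has subbasic opens $\mathcal O(x)=\{U\in\mathcal OX\mid x\in U\}$, $x\in X$. A point-continuous valuation is a valuation that is continuous from $\mathcal OX$ with the point topology to $\overline{\mathbb R}_+$. The Dirac mass $\delta_x$ ($\delta_x(U)=1$ if $x\in U$, and $0$ otherwise) is point-continuous. $\mathcal V_{\mathrm p}X$ is the set of point-continuous valuations on $X$ with the (weak) topology generated by the subbasic sets $\{\mu\mid\mu(U)>r\}$, $U\in\mathcal OX$, $r\in\mathbb R_+$; it is a cone under pointwise operations. For continuous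 $f\colon X\to Y$, $\mathcal V_{\mathrm p}f(\mu)(V)=\mu(f^{-1}(V))$. On every weakly locally convex sober topological cone $X$ there is a unique continuous linear map $\mathcal V_{\mathrm p}X\to X$ sending $\delta_x$ to $x$ for every $x$, and it is the structure map of an Eilenberg–Moore algebra of the monad $\mathcal V_{\mathrm p}$ on $T_0$ spaces (unit $x\mapsto\delta_x$, multiplication $\varpi\mapsto(U\mapsto\int\mu(U)\,d\varpi)$). A $\mathcal V_{\mathrm p}$-algebra morphism from $(X,\alpha)$ to $(Y,\beta)$ is a continuous map $f\colon X\to Y$ with $\beta\circ\mathcal V_{\mathrm p}f=f\circ\alpha$. Cones. A cone is a commutative monoid $(C,+,0)$ with a scalar multiplication $\mathbb R_+\times C\to C$ such that $r(x+y)=rx+ry$, $(r+s)x=rx+sx$, $(rs)x=r(sx)$, $1x=x$, $0x=0$, $r0=0$. A topological cone is a cone with a $T_0$ topology making $+$ and scalar multiplication jointly continuous. A map $f$ between cones is linear if $f(rx+sy)=rf(x)+sf(y)$ for all $r,s\in\mathbb R_+$. A subset $A$ of a cone is convex if $ra+(1-r)b\in A$ for all $a,b\in A$, $r\in[0,1]$. A cone with a $T_0$ topology is weakly locally convex if for every point $x$, every open neighbourhood of $x$ contains a convex (not necessarily open) neighbourhood of $x$. *)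

theory Defs
  imports "HOL-Analysis.Analysis" "HOL-Algebra.Module"
begin

section \<open>Topologies\<close>

text \<open>
  The types \<^typ>\<open>real\<close> and \<^typ>\<open>ennreal\<close> carry their usual Hausdorff topologies as type class
  instances.  Scott continuity is therefore expressed through the following abstract topologies.
\<close>

definition scott_real :: "real topology" where
  "scott_real = topology_generated_by (insert {0..} {{r<..} | r. 0 \<le> r})"

definition scott_ennreal :: "ennreal topology" where
  "scott_ennreal = topology_generated_by (insert UNIV {{ennreal r<..} | r. 0 \<le> r})"

definition irreducible_closed :: "'a topology \<Rightarrow> 'a set \<Rightarrow> bool" where
  "irreducible_closed T C \<longleftrightarrow> closedin T C \<and> C \<noteq> {} \<and>
     (\<forall>A B. closedin T A \<and> closedin T B \<and> C \<subseteq> A \<union> B \<longrightarrow> C \<subseteq> A \<or> C \<subseteq> B)"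

definition sober_space :: "'a topology \<Rightarrow> bool" where
  "sober_space T \<longleftrightarrow>
     (\<forall>C. irreducible_closed T C \<longrightarrow> (\<exists>!x. x \<in> topspace T \<and> C = T closure_of {x}))"

section \<open>Cones\<close>

text \<open>
  As for modules in HOL-Algebra, the \<^const>\<open>mult\<close> and \<^const>\<open>one\<close> fields of the record are not
  used.  Scalars are the non-negative elements of \<^typ>\<open>real\<close>; the value of the scalar
  multiplication on negative numbers is irrelevant.
\<close>

locale cone = abelian_monoid C for C :: "(real, 'a) module" (structure) +
  assumes scale_closed: "\<lbrakk>0 \<le> r; x \<in> carrier C\<rbrakk> \<Longrightarrow> r \<odot> x \<in> carrier C"
    and scale_add_right: "\<lbrakk>0 \<le> r; x \<in> carrier C; y \<in> carrier C\<rbrakk> \<Longrightarrow> r \<odot> (x \<oplus> y) = r \<odot> x \<oplus> r \<odot> y"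
    and scale_add_left: "\<lbrakk>0 \<le> r; 0 \<le> s; x \<in> carrier C\<rbrakk> \<Longrightarrow> (r + s) \<odot> x = r \<odot> x \<oplus> s \<odot> x"
    and scale_scale: "\<lbrakk>0 \<le> r; 0 \<le> s; x \<in> carrier C\<rbrakk> \<Longrightarrow> (r * s) \<odot> x = r \<odot> (s \<odot> x)"
    and scale_one: "x \<in> carrier C \<Longrightarrow> 1 \<odot> x = x"
    and scale_zero_left: "x \<in> carrier C \<Longrightarrow> 0 \<odot> x = \<zero>"
    and scale_zero_right: "0 \<le> r \<Longrightarrow> r \<odot> \<zero> = \<zero>"

locale topological_cone = cone C for C :: "(real, 'a) module" (structure) +
  fixes T :: "'a topology"
  assumes topspace_eq: "topspace T = carrier C"
    and t0: "t0_space T"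
    and continuous_add: "continuous_map (prod_topology T T) T (\<lambda>(x, y). x \<oplus> y)"
    and continuous_scale: "continuous_map (prod_topology scott_real T) T (\<lambda>(r, x). r \<odot> x)"

definition cone_linear :: "(real, 'a) module \<Rightarrow> (real, 'b) module \<Rightarrow> ('a \<Rightarrow> 'b) \<Rightarrow> bool" where
  "cone_linear C D f \<longleftrightarrow> f \<in> carrier C \<rightarrow> carrier D \<and>
     (\<forall>r\<ge>0. \<forall>s\<ge>0. \<forall>x\<in>carrier C. \<forall>y\<in>carrier C.
        f (r \<odot>\<^bsub>C\<^esub> x \<oplus>\<^bsub>C\<^esub> s \<odot>\<^bsub>C\<^esub> y) = r \<odot>\<^bsub>D\<^esub> f x \<oplus>\<^bsub>D\<^esub> s \<odot>\<^bsub>D\<^esub> f y)"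

definition cone_convex :: "(real, 'a) module \<Rightarrow> 'a set \<Rightarrow> bool" where
  "cone_convex C A \<longleftrightarrow> A \<subseteq> carrier C \<and>
     (\<forall>a\<in>A. \<forall>b\<in>A. \<forall>r\<in>{0..1}. r \<odot>\<^bsub>C\<^esub> a \<oplus>\<^bsub>C\<^esub> (1 - r) \<odot>\<^bsub>C\<^esub> b \<in> A)"

definition weakly_locally_convex :: "(real, 'a) module \<Rightarrow> 'a topology \<Rightarrow> bool" where
  "weakly_locally_convex C T \<longleftrightarrow>
     (\<forall>U x. openin T U \<and> x \<in> U \<longrightarrow>
        (\<exists>A V. cone_convex C A \<and> openin T V \<and> x \<in> V \<and> V \<subseteq> A \<and> A \<subseteq> U))"

section \<open>Point-continuous valuations\<close>

definition valuation :: "'a topology \<Rightarrow> ('a set \<Rightarrow> ennreal) \<Rightarrow> bool" where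
  "valuation X \<mu> \<longleftrightarrow> \<mu> {} = 0 \<and>
     (\<forall>U V. openin X U \<and> openin X V \<and> U \<subseteq> V \<longrightarrow> \<mu> U \<le> \<mu> V) \<and>
     (\<forall>U V. openin X U \<and> openin X V \<longrightarrow> \<mu> U + \<mu> V = \<mu> (U \<union> V) + \<mu> (U \<inter> V))"

definition point_topology :: "'a topology \<Rightarrow> 'a set topology" where
  "point_topology X = topology_generated_by
     (insert (Collect (openin X)) {{U. openin X U \<and> x \<in> U} | x. x \<in> topspace X})"

text \<open>
  A valuation is a map on the lattice of opens.  It is represented by a function that is
  \<^const>\<open>undefined\<close> on the sets that are not open, so that equality is equality of such maps.
\<close>

definition point_continuous_valuations :: "'a topology \<Rightarrow> ('a set \<Rightarrow> ennreal) set" where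
  "point_continuous_valuations X =
     {\<mu> \<in> extensional (Collect (openin X)).
        valuation X \<mu> \<and> continuous_map (point_topology X) scott_ennreal \<mu>}"

definition Vp :: "'a topology \<Rightarrow> ('a set \<Rightarrow> ennreal) topology" where
  "Vp X = topology_generated_by
     (insert (point_continuous_valuations X)
        {{\<mu> \<in> point_continuous_valuations X. ennreal r < \<mu> U} | U r. openin X U \<and> 0 \<le> r})"

definition Vp_cone :: "'a topology \<Rightarrow> (real, 'a set \<Rightarrow> ennreal) module" where
  "Vp_cone X =
     \<lparr>carrier = point_continuous_valuations X, mult = undefined, one = undefined,
      zero = (\<lambda>U\<in>Collect (openin X). 0),
      add = (\<lambda>\<mu> \<nu>. \<lambda>U\<in>Collect (openin X). \<mu> U + \<nu> U),
      smult = (\<lambda>r \<mu>. \<lambda>U\<in>Collect (openin X). ennreal r * \<mu> U)\<rparr>"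

definition dirac :: "'a topology \<Rightarrow> 'a \<Rightarrow> 'a set \<Rightarrow> ennreal" where
  "dirac X x = (\<lambda>U\<in>Collect (openin X). if x \<in> U then 1 else 0)"

definition Vp_map ::
  "'a topology \<Rightarrow> 'b topology \<Rightarrow> ('a \<Rightarrow> 'b) \<Rightarrow> ('a set \<Rightarrow> ennreal) \<Rightarrow> 'b set \<Rightarrow> ennreal" where
  "Vp_map X Y f \<mu> = (\<lambda>V\<in>Collect (openin Y). \<mu> {x \<in> topspace X. f x \<in> V})"

text \<open>
  On a weakly locally convex sober topological cone there is exactly one such map (up to its values
  outside \<^term>\<open>topspace (Vp T)\<close>), and it is the structure map of an algebra of the monad.
\<close>

definition Vp_structure_map ::
  "(real, 'a) module \<Rightarrow> 'a topology \<Rightarrow> (('a set \<Rightarrow> ennreal) \<Rightarrow> 'a) \<Rightarrow> bool" where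
  "Vp_structure_map C T \<alpha> \<longleftrightarrow> continuous_map (Vp T) T \<alpha> \<and> cone_linear (Vp_cone T) C \<alpha> \<and>
     (\<forall>x\<in>topspace T. \<alpha> (dirac T x) = x)"

definition Vp_algebra_morphism ::
  "'a topology \<Rightarrow> (('a set \<Rightarrow> ennreal) \<Rightarrow> 'a) \<Rightarrow> 'b topology \<Rightarrow> (('b set \<Rightarrow> ennreal) \<Rightarrow> 'b) \<Rightarrow>
     ('a \<Rightarrow> 'b) \<Rightarrow> bool" where
  "Vp_algebra_morphism X \<alpha> Y \<beta> f \<longleftrightarrow> continuous_map X Y f \<and>
     (\<forall>\<mu>\<in>topspace (Vp X). \<beta> (Vp_map X Y f \<mu>) = f (\<alpha> \<mu>))"

section \<open>Basic facts\<close>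

lemma topspace_scott_real [simp]: "topspace scott_real = {0..}"
  unfolding scott_real_def topology_generated_by_topspace by force

lemma topspace_scott_ennreal [simp]: "topspace scott_ennreal = UNIV"
  unfolding scott_ennreal_def topology_generated_by_topspace by auto

lemma topspace_point_topology [simp]: "topspace (point_topology X) = Collect (openin X)"
  unfolding point_topology_def topology_generated_by_topspace by auto

lemma topspace_Vp [simp]: "topspace (Vp X) = point_continuous_valuations X"
  unfolding Vp_def topology_generated_by_topspace by auto

lemma openin_scott_real:
  "openin scott_real U \<longleftrightarrow> U = {} \<or> U = {0..} \<or> (\<exists>r\<ge>0. U = {r<..})" (is "_ \<longleftrightarrow> ?P U")
proof
  let ?S = "insert {0..} {{r<..} | r::real. 0 \<le> r}"
  assume "openin scott_real U"
  then have "generate_topology_on ?S U"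
    by (simp add: scott_real_def openin_topology_generated_by_iff)
  then show "?P U"
  proof induction
    case (Int a b)
    have "{r<..} \<inter> {s<..} = {max r s<..}" for r s :: real
      by auto
    moreover have "{0..} \<inter> {r<..} = {r<..}" "{r<..} \<inter> {0..} = {r<..}" if "0 \<le> r" for r :: real
      using that by auto
    ultimately show ?case
      using Int.IH by (elim disjE exE conjE) (auto simp: le_max_iff_disj)
  next
    case (UN K)
    define R where "R = {r. 0 \<le> r \<and> {r<..} \<in> K}"
    show ?case
    proof (cases "{0..} \<in> K \<or> R = {}")
      case True
      have "k \<subseteq> {0..}" if "k \<in> K" for k
        using UN.IH[OF that] by auto
      then have "\<Union>K = {0..}" if "{0..} \<in> K"
        using that by blast
      moreover have "\<Union>K = {}" if "{0..} \<notin> K" "R = {}"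
        using UN.IH that unfolding R_def by blast
      ultimately show ?thesis
        using True by blast
    next
      case False
      then have "\<Union>K = (\<Union>r\<in>R. {r<..})"
        using UN.IH unfolding R_def by blast
      moreover have "(\<Union>r\<in>R. {r<..}) = {Inf R<..}"
      proof -
        have "R \<noteq> {}" "bdd_below R"
          using False by (auto simp: R_def bdd_below_def)
        then have "Inf R < x \<longleftrightarrow> (\<exists>r\<in>R. r < x)" for x
          by (rule cInf_less_iff)
        then show ?thesis
          by auto
      qed
      moreover have "0 \<le> Inf R"
        using False by (intro cInf_greatest) (auto simp: R_def)
      ultimately show ?thesis
        by (intro disjI2 exI[of _ "Inf R"]) simp
    qed
  qed auto
next
  assume "?P U"
  then show "openin scott_real U"
    unfolding scott_real_def by (auto intro: topology_generated_by_Basis)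
qed

lemma openin_scott_ennreal:
  "openin scott_ennreal U \<longleftrightarrow> U = {} \<or> U = UNIV \<or> (\<exists>r\<ge>0. U = {ennreal r<..})" (is "_ \<longleftrightarrow> ?P U")
proof
  let ?S = "insert UNIV {{ennreal r<..} | r. 0 \<le> r}"
  assume "openin scott_ennreal U"
  then have "generate_topology_on ?S U"
    by (simp add: scott_ennreal_def openin_topology_generated_by_iff)
  then show "?P U"
  proof induction
    case (Int a b)
    have "{ennreal r<..} \<inter> {ennreal s<..} = {ennreal (max r s)<..}" if "0 \<le> r" "0 \<le> s" for r s
    proof -
      have "max (ennreal r) (ennreal s) = ennreal (max r s)"
        by (cases "r \<le> s") (auto simp: max_def ennreal_leI antisym)
      then show ?thesis
        by (auto simp flip: \<open>max (ennreal r) (ennreal s) = ennreal (max r s)\<close>)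
    qed
    then have "\<exists>t\<ge>0. {ennreal r<..} \<inter> {ennreal s<..} = {ennreal t<..}" if "0 \<le> r" "0 \<le> s" for r s
      using that by (metis max.coboundedI1)
    then show ?case
      using Int.IH by (metis Int_empty_left Int_empty_right Int_UNIV_left Int_UNIV_right)
  next
    case (UN K)
    define R where "R = {r. 0 \<le> r \<and> {ennreal r<..} \<in> K}"
    show ?case
    proof (cases "UNIV \<in> K \<or> R = {}")
      case True
      have "\<Union>K = {}" if "UNIV \<notin> K" "R = {}"
        using UN.IH that unfolding R_def by blast
      then show ?thesis
        using True by blast
    next
      case False
      then have "\<Union>K = (\<Union>r\<in>R. {ennreal r<..})"
        using UN.IH unfolding R_def by blast
      also have "\<dots> = {Inf (ennreal ` R)<..}"
        by (auto simp: Inf_less_iff)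
      finally have "\<Union>K = {Inf (ennreal ` R)<..}" .
      moreover obtain r where "r \<in> R"
        using False by blast
      then have "Inf (ennreal ` R) \<le> ennreal r"
        by (auto intro: Inf_lower)
      then have "Inf (ennreal ` R) < \<infinity>"
        by (simp add: infinity_ennreal_def le_less_trans)
      then obtain q where "0 \<le> q" "Inf (ennreal ` R) = ennreal q"
        by (cases "Inf (ennreal ` R)" rule: ennreal_cases) auto
      ultimately show ?thesis
        by auto
    qed
  qed auto
next
  assume "?P U"
  then show "openin scott_ennreal U"
    unfolding scott_ennreal_def by (auto intro: topology_generated_by_Basis)
qed

lemma continuous_map_scott_ennreal_iff:
  "continuous_map X scott_ennreal f \<longleftrightarrow> (\<forall>r\<ge>0. openin X {x \<in> topspace X. ennreal r < f x})"
  unfolding continuous_map_def openin_scott_ennreal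
  by (auto simp: conj_disj_distribR dest: spec[of _ "{_<..}"])

lemma dirac_in_Vp:
  assumes "x \<in> topspace X"
  shows "dirac X x \<in> point_continuous_valuations X"
proof -
  have "openin (point_topology X) {U. openin X U \<and> ennreal r < dirac X x U}" if "0 \<le> r" for r
  proof (cases "r < 1")
    case True
    then have "{U. openin X U \<and> ennreal r < dirac X x U} = {U. openin X U \<and> x \<in> U}"
      using that by (auto simp: dirac_def ennreal_less_one_iff split: if_splits)
    then show ?thesis
      unfolding point_topology_def using assms by (auto intro!: topology_generated_by_Basis)
  next
    case False
    then have "\<not> ennreal r < 1"
      by (simp add: ennreal_less_one_iff)
    then have "{U. openin X U \<and> ennreal r < dirac X x U} = {}"
      by (auto simp: dirac_def split: if_splits)
    then show ?thesis
      by (metis openin_empty)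
  qed
  moreover have "valuation X (dirac X x)"
    by (auto simp: valuation_def dirac_def)
  ultimately show ?thesis
    by (auto simp: point_continuous_valuations_def continuous_map_scott_ennreal_iff dirac_def)
qed

lemma cone_Vp_cone: "cone (Vp_cone X)"
proof -
  let ?V = "point_continuous_valuations X" and ?O = "Collect (openin X)"
  have V_iff: "\<mu> \<in> ?V \<longleftrightarrow> \<mu> \<in> extensional ?O \<and> valuation X \<mu> \<and>
      (\<forall>r\<ge>0. openin (point_topology X) {U. openin X U \<and> ennreal r < \<mu> U})" for \<mu>
    by (simp add: point_continuous_valuations_def continuous_map_scott_ennreal_iff)
  have zero: "(\<lambda>U\<in>?O. 0) \<in> ?V"
    by (auto simp: V_iff valuation_def cong: conj_cong)
  have add: "(\<lambda>U\<in>?O. \<mu> U + \<nu> U) \<in> ?V" if \<mu>: "\<mu> \<in> ?V" and \<nu>: "\<nu> \<in> ?V" for \<mu> \<nu>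
  proof -
    have "valuation X (\<lambda>U\<in>?O. \<mu> U + \<nu> U)"
    proof -
      have "\<mu> U + \<nu> U + (\<mu> V + \<nu> V) =
          \<mu> (U \<union> V) + \<nu> (U \<union> V) + (\<mu> (U \<inter> V) + \<nu> (U \<inter> V))"
        if "openin X U" "openin X V" for U V
      proof -
        have "\<mu> U + \<mu> V = \<mu> (U \<union> V) + \<mu> (U \<inter> V)" "\<nu> U + \<nu> V = \<nu> (U \<union> V) + \<nu> (U \<inter> V)"
          using \<mu> \<nu> that by (auto simp: V_iff valuation_def)
        then show ?thesis
          by (metis add.assoc add.left_commute)
      qed
      then show ?thesis
        using \<mu> \<nu> by (auto simp: V_iff valuation_def intro!: add_mono)
    qed
    moreover have "openin (point_topology X) {U. openin X U \<and> ennreal r < \<mu> U + \<nu> U}"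
      if "0 \<le> r" for r
    proof -
      have split: "ennreal r < a + b \<longleftrightarrow> ennreal r < a \<or> ennreal r < b \<or>
          (\<exists>s t. 0 \<le> s \<and> 0 \<le> t \<and> r \<le> s + t \<and> ennreal s < a \<and> ennreal t < b)" for a b
      proof
        assume *: "ennreal r < a + b"
        show "ennreal r < a \<or> ennreal r < b \<or>
          (\<exists>s t. 0 \<le> s \<and> 0 \<le> t \<and> r \<le> s + t \<and> ennreal s < a \<and> ennreal t < b)"
        proof (cases "ennreal r < a \<or> ennreal r < b")
          case False
          then have "a < \<infinity>" "b < \<infinity>"
            by (auto simp: not_less infinity_ennreal_def intro: le_less_trans)
          then obtain a' b' where ab: "a = ennreal a'" "b = ennreal b'" "0 \<le> a'" "0 \<le> b'"
            by (metis ennreal_cases less_irrefl infinity_ennreal_def)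
          have "a' \<le> r" "b' \<le> r" "r < a' + b'"
            using False * that ab by (auto simp: ennreal_less_iff not_less simp flip: ennreal_plus)
          define d where "d = (a' + b' - r) / 2"
          have "0 < d" "d < a'" "d < b'" "r \<le> (a' - d) + (b' - d)"
            using ab \<open>a' \<le> r\<close> \<open>b' \<le> r\<close> \<open>r < a' + b'\<close> by (auto simp: d_def field_simps)
          then have "ennreal (a' - d) < a" "ennreal (b' - d) < b"
            using ab by (auto simp: ennreal_less_iff)
          then show ?thesis
            using \<open>d < a'\<close> \<open>d < b'\<close> \<open>r \<le> (a' - d) + (b' - d)\<close>
            by (intro disjI2 exI[of _ "a' - d"] exI[of _ "b' - d"]) auto
        qed auto
      next
        have "ennreal r < a + b" if "r \<le> s + t" "ennreal s < a" "ennreal t < b" "0 \<le> s" "0 \<le> t"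
          for s t
        proof -
          have "ennreal r \<le> ennreal s + ennreal t"
            using that by (metis ennreal_leI ennreal_plus)
          also have "\<dots> < a + b"
            using that by (intro add_strict_mono)
          finally show ?thesis .
        qed
        then show "ennreal r < a \<or> ennreal r < b \<or>
          (\<exists>s t. 0 \<le> s \<and> 0 \<le> t \<and> r \<le> s + t \<and> ennreal s < a \<and> ennreal t < b) \<Longrightarrow> ennreal r < a + b"
          by (metis add_increasing add_increasing2 le_less_trans less_le_trans order_refl zero_le)
      qed
      let ?A = "\<lambda>\<mu> s. {U. openin X U \<and> ennreal s < \<mu> U}"
      have eq: "?A (\<lambda>U. \<mu> U + \<nu> U) r = ?A \<mu> r \<union> ?A \<nu> r \<union>
          (\<Union>(s, t)\<in>{(s, t). 0 \<le> s \<and> 0 \<le> t \<and> r \<le> s + t}. ?A \<mu> s \<inter> ?A \<nu> t)"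
        unfolding split by auto
      show ?thesis
        unfolding eq using \<mu> \<nu> that by (intro openin_Un openin_clauses(3) ballI) (auto simp: V_iff)
    qed
    ultimately show ?thesis
      by (auto simp: V_iff cong: conj_cong)
  qed
  have scale: "(\<lambda>U\<in>?O. ennreal r * \<mu> U) \<in> ?V" if \<mu>: "\<mu> \<in> ?V" and "0 \<le> r" for r \<mu>
  proof (cases "r = 0")
    case True
    then show ?thesis
      using zero by simp
  next
    case False
    with \<open>0 \<le> r\<close> have r: "0 < r"
      by simp
    have "ennreal s < ennreal r * a \<longleftrightarrow> ennreal (s / r) < a" if "0 \<le> s" for s a
    proof (cases a rule: ennreal_cases)
      case (real a')
      then show ?thesis
        using r that by (simp add: ennreal_less_iff field_simps flip: ennreal_mult)
    next
      case top
      then show ?thesis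
        using r by (simp add: ennreal_mult_top)
    qed
    then have "openin (point_topology X) {U. openin X U \<and> ennreal s < ennreal r * \<mu> U}"
      if "0 \<le> s" for s
      using \<mu> r that by (simp add: V_iff)
    moreover have "valuation X (\<lambda>U\<in>?O. ennreal r * \<mu> U)"
      using \<mu> by (auto simp: V_iff valuation_def mult_left_mono simp flip: distrib_left)
    ultimately show ?thesis
      by (auto simp: V_iff cong: conj_cong)
  qed
  have id: "restrict \<mu> ?O = \<mu>" if "\<mu> \<in> ?V" for \<mu>
    using that by (simp only: V_iff extensional_restrict)
  show ?thesis
    by unfold_locales (auto simp: Vp_cone_def zero add scale id ennreal_mult mult.assoc
      distrib_left distrib_right add_ac cong: restrict_cong)
qed

end

theory Submission
  imports Defs
begin

text \<open>
  Both \<open>\<beta> \<circ> \<V>\<^sub>p f\<close> and \<open>f \<circ> \<alpha>\<close> are continuous linear maps that send \<open>\<delta>\<^sub>x\<close> to \<open>f x\<close>, so everything rests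
  on the fact that a continuous linear map on the cone of point-continuous valuations is determined
  by its values on Dirac masses.  As open sets of valuations are upwards closed and the codomain is
  \<open>T\<^sub>0\<close>, it suffices to find, for finitely many inequalities \<open>r < \<mu> U\<close>, a finite combination of
  Dirac masses that lies below \<open>\<mu>\<close> and satisfies the same inequalities.

  For a single \<open>U\<close>, point continuity provides a finite \<open>F \<subseteq> U\<close> whose open neighbourhoods all
  have measure greater than \<open>r\<close>.  The set function \<open>A \<mapsto> inf {\<mu> V | A \<subseteq> V}\<close> on subsets of \<open>F\<close> is
  submodular, and the greedy algorithm gives weights on \<open>F\<close> that are dominated by it and have the
  same total mass.  Finitely many sets of finite measure are treated by repeatedly splitting \<open>\<mu>\<close>
  into its parts inside and outside one of them; sets of infinite measure are added by taking convex
  combinations with a small weight on a valuation of large mass.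
\<close>

section \<open>Finite combinations of point masses\<close>

text \<open>The values are real and defined on all sets rather than only on opens, since the greedy
  construction compares them on finite sets of points.\<close>

inductive simple_mass :: "'a topology \<Rightarrow> ('a set \<Rightarrow> real) \<Rightarrow> bool" for X where
  zero: "simple_mass X (\<lambda>U. 0)"
| add_point: "\<lbrakk>simple_mass X s; x \<in> topspace X; 0 \<le> r\<rbrakk> \<Longrightarrow>
    simple_mass X (\<lambda>U. r * indicator U x + s U)"

lemma simple_mass_nonneg: "simple_mass X s \<Longrightarrow> 0 \<le> s U"
  by (induction rule: simple_mass.induct) auto

lemma simple_mass_mono: "\<lbrakk>simple_mass X s; U \<subseteq> V\<rbrakk> \<Longrightarrow> s U \<le> s V"
  by (induction rule: simple_mass.induct)
     (auto intro!: add_mono mult_left_mono simp: indicator_def)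

lemma simple_mass_scale: "\<lbrakk>simple_mass X s; 0 \<le> c\<rbrakk> \<Longrightarrow> simple_mass X (\<lambda>U. c * s U)"
proof (induction rule: simple_mass.induct)
  case zero
  then show ?case
    by (simp add: simple_mass.zero)
next
  case (add_point s x r)
  then show ?case
    using simple_mass.add_point[of X "\<lambda>U. c * s U" x "c * r"] by (simp add: algebra_simps)
qed

lemma simple_mass_add:
  assumes "simple_mass X s" "simple_mass X t"
  shows "simple_mass X (\<lambda>U. s U + t U)"
  using assms(1)
proof (induction rule: simple_mass.induct)
  case zero
  then show ?case
    by (simp add: assms(2))
next
  case (add_point s x r)
  then show ?case
    using simple_mass.add_point[of X "\<lambda>U. s U + t U" x r] by (simp add: add.assoc)
qed

section \<open>Point masses dominated by a submodular set function\<close>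

text \<open>Points are added one at a time, each weighted by the increment of \<open>c\<close>. By
  submodularity increments shrink as the set grows, so the weight of \<open>x\<close> is at most its
  increment over \<open>A \<inter> F\<close>, and domination persists. The increments telescope to
  the total mass.\<close>

lemma submodular_greedy:
  fixes c :: "'a set \<Rightarrow> real"
  assumes "finite F" "F \<subseteq> topspace X" "c {} = 0"
    and mono: "\<And>A B. \<lbrakk>A \<subseteq> B; B \<subseteq> F\<rbrakk> \<Longrightarrow> c A \<le> c B"
    and submodular: "\<And>A B. \<lbrakk>A \<subseteq> F; B \<subseteq> F\<rbrakk> \<Longrightarrow> c (A \<union> B) + c (A \<inter> B) \<le> c A + c B"
  shows "\<exists>s. simple_mass X s \<and> (\<forall>A. s A \<le> c (A \<inter> F)) \<and> c F \<le> s F"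
  using assms
proof (induction F rule: finite_induct)
  case empty
  then show ?case
    by (auto intro!: exI[of _ "\<lambda>_. 0"] simple_mass.zero)
next
  case (insert x F)
  have "\<exists>s. simple_mass X s \<and> (\<forall>A. s A \<le> c (A \<inter> F)) \<and> c F \<le> s F"
    by (rule insert.IH) (use insert.prems in \<open>auto simp: subset_insertI2\<close>)
  then obtain s where s: "simple_mass X s" "\<And>A. s A \<le> c (A \<inter> F)" "c F \<le> s F"
    by blast
  define w where "w = c (insert x F) - c F"
  have "0 \<le> w"
    unfolding w_def using insert.prems(3)[of F "insert x F"] by auto
  have "w * indicator A x + s A \<le> c (A \<inter> insert x F)" for A
  proof (cases "x \<in> A")
    case True
    have "insert x (A \<inter> F) \<union> F = insert x F" "insert x (A \<inter> F) \<inter> F = A \<inter> F"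
      using insert.hyps by auto
    then have "c (insert x F) + c (A \<inter> F) \<le> c (insert x (A \<inter> F)) + c F"
      using insert.prems(4)[of "insert x (A \<inter> F)" F] by auto
    moreover have "A \<inter> insert x F = insert x (A \<inter> F)"
      using True by auto
    ultimately show ?thesis
      using True s(2)[of A] by (simp add: w_def)
  next
    case False
    then show ?thesis
      using s(2)[of A] by simp
  qed
  \<comment> \<open>The support of \<open>s\<close> is not recorded, so monotonicity bounds
    \<open>s (insert x F)\<close> from below by \<open>s F\<close>.\<close>
  moreover have "c (insert x F) \<le> w * indicator (insert x F) x + s (insert x F)"
    using s(3) simple_mass_mono[OF s(1) subset_insertI, of F x] by (simp add: w_def)
  ultimately show ?case
    using simple_mass.add_point[OF s(1) _ \<open>0 \<le> w\<close>, of x] insert.prems(1)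
    by (intro exI[of _ "\<lambda>A. w * indicator A x + s A"]) auto
qed

text \<open>The infimum of \<open>m\<close> over open neighbourhoods inherits monotonicity and
  submodularity, since neighbourhoods of \<open>A\<close> and \<open>B\<close> have unions and
  intersections that are neighbourhoods of \<open>A \<union> B\<close> and
  \<open>A \<inter> B\<close>. Asking for submodularity rather than modularity admits truncated
  valuations.\<close>

lemma submodular_on_opens_greedy:
  fixes m :: "'a set \<Rightarrow> real"
  assumes F: "finite F" "F \<subseteq> topspace X" and "m {} = 0"
    and mono: "\<And>U V. \<lbrakk>openin X U; openin X V; U \<subseteq> V\<rbrakk> \<Longrightarrow> m U \<le> m V"
    and submodular: "\<And>U V. \<lbrakk>openin X U; openin X V\<rbrakk> \<Longrightarrow> m (U \<union> V) + m (U \<inter> V) \<le> m U + m V"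
    and t: "\<And>V. \<lbrakk>openin X V; F \<subseteq> V\<rbrakk> \<Longrightarrow> t \<le> m V"
  shows "\<exists>s. simple_mass X s \<and> (\<forall>V. openin X V \<longrightarrow> s V \<le> m V) \<and> t \<le> s F"
proof -
  define N where "N A = {V. openin X V \<and> A \<subseteq> V}" for A
  define c where "c A = Inf (m ` N A)" for A
  \<comment> \<open>\<open>topspace X\<close> is an open neighbourhood of \<open>A\<close>, so the
    real infimum ranges over a nonempty set.\<close>
  have N_ne: "m ` N A \<noteq> {}" if "A \<subseteq> F" for A
    using that F(2) by (auto simp: N_def)
  have nonneg: "0 \<le> m V" if "openin X V" for V
    using mono[of "{}" V] that \<open>m {} = 0\<close> by simp
  then have bdd: "bdd_below (m ` N A)" for A
    by (auto simp: N_def intro!: bdd_belowI[of _ 0])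
  have lower: "c A \<le> m V" if "openin X V" "A \<subseteq> V" for A V
    unfolding c_def using that bdd by (intro cInf_lower) (auto simp: N_def)
  have greatest: "a \<le> c A" if "A \<subseteq> F" "\<And>V. \<lbrakk>openin X V; A \<subseteq> V\<rbrakk> \<Longrightarrow> a \<le> m V" for a A
    unfolding c_def using that N_ne by (intro cInf_greatest) (auto simp: N_def)
  have "\<exists>s. simple_mass X s \<and> (\<forall>A. s A \<le> c (A \<inter> F)) \<and> c F \<le> s F"
  proof (rule submodular_greedy[OF F])
    show "c {} = 0"
      using lower[of "{}" "{}"] greatest[of "{}" 0] nonneg \<open>m {} = 0\<close> by force
    show "c A \<le> c B" if "A \<subseteq> B" "B \<subseteq> F" for A B
      using that by (intro greatest lower) auto
    show "c (A \<union> B) + c (A \<inter> B) \<le> c A + c B" if "A \<subseteq> F" "B \<subseteq> F" for A B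
    proof -
      \<comment> \<open>The two infima are taken in turn: over \<open>U\<close> with
        \<open>V\<close> fixed here, over \<open>V\<close> afterwards.\<close>
      have "c (A \<union> B) + c (A \<inter> B) - m V \<le> c A" if "openin X V" "B \<subseteq> V" for V
      proof (rule greatest[OF \<open>A \<subseteq> F\<close>])
        fix U assume "openin X U" "A \<subseteq> U"
        then show "c (A \<union> B) + c (A \<inter> B) - m V \<le> m U"
          using that submodular[of U V] lower[of "U \<union> V" "A \<union> B"] lower[of "U \<inter> V" "A \<inter> B"]
          by fastforce
      qed
      then have "c (A \<union> B) + c (A \<inter> B) - c A \<le> c B"
        by (intro greatest[OF \<open>B \<subseteq> F\<close>]) (simp add: algebra_simps)
      then show ?thesis
        by simp
    qed
  qed
  then obtain s where s: "simple_mass X s" "\<And>A. s A \<le> c (A \<inter> F)" "c F \<le> s F"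
    by blast
  have "s V \<le> m V" if "openin X V" for V
    using s(2)[of V] lower[OF that, of "V \<inter> F"] by simp
  moreover have "t \<le> s F"
    using greatest[of F t] t s(3) by fastforce
  ultimately show ?thesis
    using s(1) by blast
qed

section \<open>Finite point-continuous valuations\<close>

text \<open>Real values make it possible to subtract the mass of a set. \<open>approx\<close> is
  point continuity expressed through finite sets of points.\<close>

locale finite_valuation =
  fixes X :: "'a topology" and m :: "'a set \<Rightarrow> real"
  assumes empty: "m {} = 0"
    and mono: "\<lbrakk>openin X U; openin X V; U \<subseteq> V\<rbrakk> \<Longrightarrow> m U \<le> m V"
    and modular: "\<lbrakk>openin X U; openin X V\<rbrakk> \<Longrightarrow> m U + m V = m (U \<union> V) + m (U \<inter> V)"
    and approx: "\<lbrakk>openin X U; 0 < e\<rbrakk> \<Longrightarrow>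
      \<exists>F. finite F \<and> F \<subseteq> U \<and> (\<forall>V. openin X V \<and> F \<subseteq> V \<longrightarrow> m U - e \<le> m V)"
begin

text \<open>A finite set chosen for \<open>V \<inter> U\<close> lies in \<open>U\<close>, so an open
  set around it still contains it after intersection with \<open>U\<close>.\<close>

lemma restrict_inside:
  assumes U: "openin X U"
  shows "finite_valuation X (\<lambda>V. m (V \<inter> U))"
proof
  show "m ({} \<inter> U) = 0"
    by (simp add: empty)
  show "m (V \<inter> U) \<le> m (W \<inter> U)" if "openin X V" "openin X W" "V \<subseteq> W" for V W
    using that U by (intro mono) auto
  show "m (V \<inter> U) + m (W \<inter> U) = m ((V \<union> W) \<inter> U) + m (V \<inter> W \<inter> U)"
    if "openin X V" "openin X W" for V W
  proof -
    have "V \<inter> U \<union> W \<inter> U = (V \<union> W) \<inter> U" "(V \<inter> U) \<inter> (W \<inter> U) = V \<inter> W \<inter> U"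
      by auto
    then show ?thesis
      using modular[of "V \<inter> U" "W \<inter> U"] that U by (metis openin_Int)
  qed
  show "\<exists>F. finite F \<and> F \<subseteq> V \<and> (\<forall>W. openin X W \<and> F \<subseteq> W \<longrightarrow> m (V \<inter> U) - e \<le> m (W \<inter> U))"
    if V: "openin X V" and "0 < e" for V e
  proof -
    obtain F where "finite F" "F \<subseteq> V \<inter> U"
      "\<And>W. \<lbrakk>openin X W; F \<subseteq> W\<rbrakk> \<Longrightarrow> m (V \<inter> U) - e \<le> m W"
      using approx[of "V \<inter> U" e] V U \<open>0 < e\<close> by blast
    then show ?thesis
      using U by (intro exI[of _ F]) auto
  qed
qed

text \<open>By modularity the new value at \<open>V\<close> is
  \<open>m V - m (V \<inter> U)\<close>: what remains of \<open>m\<close> once its part inside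
  \<open>U\<close> is removed.\<close>

lemma restrict_outside:
  assumes U: "openin X U"
  shows "finite_valuation X (\<lambda>V. m (V \<union> U) - m U)"
proof
  show "m ({} \<union> U) - m U = 0"
    by simp
  show "m (V \<union> U) - m U \<le> m (W \<union> U) - m U" if "openin X V" "openin X W" "V \<subseteq> W" for V W
    using that U by (intro diff_right_mono mono) auto
  show "m (V \<union> U) - m U + (m (W \<union> U) - m U) =
      m (V \<union> W \<union> U) - m U + (m (V \<inter> W \<union> U) - m U)" if "openin X V" "openin X W" for V W
  proof -
    have "V \<union> U \<union> (W \<union> U) = V \<union> W \<union> U" "(V \<union> U) \<inter> (W \<union> U) = V \<inter> W \<union> U"
      by auto
    then show ?thesis
      using modular[of "V \<union> U" "W \<union> U"] that U by (simp add: openin_Un)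
  qed
  show "\<exists>F. finite F \<and> F \<subseteq> V \<and>
      (\<forall>W. openin X W \<and> F \<subseteq> W \<longrightarrow> m (V \<union> U) - m U - e \<le> m (W \<union> U) - m U)"
    if V: "openin X V" and "0 < e" for V e
  proof -
    obtain F where F: "finite F" "F \<subseteq> V \<union> U"
      "\<And>W. \<lbrakk>openin X W; F \<subseteq> W\<rbrakk> \<Longrightarrow> m (V \<union> U) - e \<le> m W"
      using approx[of "V \<union> U" e] V U \<open>0 < e\<close> by blast
    have "m (V \<union> U) - e \<le> m (W \<union> U)" if "openin X W" "F - U \<subseteq> W" for W
      using that U by (intro F(3)) auto
    then show ?thesis
      using F by (intro exI[of _ "F - U"]) (auto simp: algebra_simps)
  qed
qed

end

text \<open>
  The sets form an indexed family because the induction replaces each \<open>U i\<close> by its intersection with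
  the set along which the valuation is split.
\<close>

lemma finite_valuation_approx:
  fixes U :: "'i \<Rightarrow> 'a set"
  assumes "finite I" "finite_valuation X m" "openin X W" "\<And>i. i \<in> I \<Longrightarrow> openin X (U i) \<and> U i \<subseteq> W"
    "0 < e"
  shows "\<exists>s. simple_mass X s \<and> (\<forall>V. openin X V \<longrightarrow> s V \<le> m V) \<and>
    m W - e \<le> s W \<and> (\<forall>i\<in>I. m (U i) - e \<le> s (U i))"
  using assms
proof (induction I arbitrary: m W U e rule: finite_induct)
  case empty
  interpret finite_valuation X m
    by fact
  obtain F where F: "finite F" "F \<subseteq> W" "\<And>V. \<lbrakk>openin X V; F \<subseteq> V\<rbrakk> \<Longrightarrow> m W - e \<le> m V"
    using approx[OF empty.prems(2,4)] by blast
  have "\<exists>s. simple_mass X s \<and> (\<forall>V. openin X V \<longrightarrow> s V \<le> m V) \<and> m W - e \<le> s F"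
  proof (rule submodular_on_opens_greedy[OF F(1)])
    show "F \<subseteq> topspace X"
      using F(2) openin_subset[OF \<open>openin X W\<close>] by blast
    show "m {} = 0"
      by (rule finite_valuation.empty) fact
    show "m (U \<union> V) + m (U \<inter> V) \<le> m U + m V" if "openin X U" "openin X V" for U V
      using modular[OF that] by simp
  qed (fact mono F(3))+
  then obtain s where s: "simple_mass X s" "\<And>V. openin X V \<Longrightarrow> s V \<le> m V" "m W - e \<le> s F"
    by blast
  moreover have "m W - e \<le> s W"
    using s(3) simple_mass_mono[OF s(1) F(2)] by simp
  ultimately show ?case
    by blast
next
  case (insert j I)
  interpret finite_valuation X m
    by fact
  have j: "openin X (U j)" "U j \<subseteq> W" and I: "\<And>i. i \<in> I \<Longrightarrow> openin X (U i)" "\<And>i. i \<in> I \<Longrightarrow> U i \<subseteq> W"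
    using insert.prems by auto
  \<comment> \<open>Inside part: \<open>U j\<close> becomes the bounding set, so the estimate for
    the bounding set is the one wanted for \<open>U j\<close>. The other sets become
    \<open>U i \<inter> U j\<close>, and each part receives half of the error.\<close>
  have "\<exists>s. simple_mass X s \<and> (\<forall>V. openin X V \<longrightarrow> s V \<le> m (V \<inter> U j)) \<and>
      m (U j \<inter> U j) - e / 2 \<le> s (U j) \<and>
      (\<forall>i\<in>I. m (U i \<inter> U j \<inter> U j) - e / 2 \<le> s (U i \<inter> U j))"
    by (rule insert.IH[OF restrict_inside]) (use j I \<open>0 < e\<close> in auto)
  then obtain s where s: "simple_mass X s" "\<And>V. openin X V \<Longrightarrow> s V \<le> m (V \<inter> U j)"
    "m (U j) - e / 2 \<le> s (U j)" "\<And>i. i \<in> I \<Longrightarrow> m (U i \<inter> U j) - e / 2 \<le> s (U i \<inter> U j)"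
    by (auto simp: Int_assoc)
  \<comment> \<open>Outside part: \<open>W\<close> and the sets \<open>U i\<close> stay the
    same.\<close>
  have "\<exists>t. simple_mass X t \<and> (\<forall>V. openin X V \<longrightarrow> t V \<le> m (V \<union> U j) - m (U j)) \<and>
      m (W \<union> U j) - m (U j) - e / 2 \<le> t W \<and>
      (\<forall>i\<in>I. m (U i \<union> U j) - m (U j) - e / 2 \<le> t (U i))"
    by (rule insert.IH[OF restrict_outside]) (use j I insert.prems in auto)
  then obtain t where t: "simple_mass X t" "\<And>V. openin X V \<Longrightarrow> t V \<le> m (V \<union> U j) - m (U j)"
    "m (W \<union> U j) - m (U j) - e / 2 \<le> t W"
    "\<And>i. i \<in> I \<Longrightarrow> m (U i \<union> U j) - m (U j) - e / 2 \<le> t (U i)"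
    by blast
  \<comment> \<open>By modularity the two parts of \<open>m\<close> add up to \<open>m\<close>,
    hence so do the bounds.\<close>
  have "s V + t V \<le> m V" if "openin X V" for V
    using s(2)[OF that] t(2)[OF that] modular[OF that j(1)] by simp
  moreover have "m W - e \<le> s W + t W"
    using s(3) t(3) j(2) simple_mass_mono[OF s(1) j(2)] by (simp add: Un_absorb2)
  \<comment> \<open>The inside estimate is for \<open>U i \<inter> U j\<close>; monotonicity of
    \<open>s\<close> carries it to \<open>U i\<close>.\<close>
  moreover have "m (U i) - e \<le> s (U i) + t (U i)" if "i \<in> I" for i
    using s(4)[OF that] t(4)[OF that] modular[OF I(1)[OF that] j(1)]
      simple_mass_mono[OF s(1), of "U i \<inter> U j" "U i"] by simp
  moreover have "m (U j) - e \<le> s (U j) + t (U j)"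
    using s(3) simple_mass_nonneg[OF t(1), of "U j"] \<open>0 < e\<close> by simp
  ultimately show ?case
    using simple_mass_add[OF s(1) t(1)] by (intro exI[of _ "\<lambda>V. s V + t V"]) auto
qed

section \<open>Approximation of point-continuous valuations\<close>

text \<open>A subbasic open set tests membership of one point; finite intersections collect finitely
  many points, and a union needs only those of one member.\<close>

lemma openin_point_topology_finite:
  assumes "openin (point_topology X) A" "U \<in> A"
  shows "\<exists>F. finite F \<and> F \<subseteq> U \<and> (\<forall>V. openin X V \<and> F \<subseteq> V \<longrightarrow> V \<in> A)"
proof -
  have "generate_topology_on
      (insert (Collect (openin X)) {{U. openin X U \<and> x \<in> U} | x. x \<in> topspace X}) A"
    using assms(1) by (simp add: point_topology_def openin_topology_generated_by_iff)
  then show ?thesis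
    using assms(2)
  proof (induction arbitrary: U)
    case (Int A B)
    from Int.IH(1)[OF IntD1[OF Int.prems]] obtain F where
      "finite F" "F \<subseteq> U" "\<forall>V. openin X V \<and> F \<subseteq> V \<longrightarrow> V \<in> A"
      by (elim exE conjE)
    moreover from Int.IH(2)[OF IntD2[OF Int.prems]] obtain G where
      "finite G" "G \<subseteq> U" "\<forall>V. openin X V \<and> G \<subseteq> V \<longrightarrow> V \<in> B"
      by (elim exE conjE)
    ultimately show ?case
      by (intro exI[of _ "F \<union> G"]) auto
  next
    case (UN K)
    from UN.prems obtain B where "B \<in> K" "U \<in> B"
      by blast
    from UN.IH[OF this] obtain F where "finite F" "F \<subseteq> U" "\<forall>V. openin X V \<and> F \<subseteq> V \<longrightarrow> V \<in> B"
      by (elim exE conjE)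
    then show ?case
      using subsetD[OF Union_upper[OF \<open>B \<in> K\<close>]] by (intro exI[of _ F]) simp
  next
    case (Basis A)
    then consider "A = Collect (openin X)" | x where "A = {U. openin X U \<and> x \<in> U}"
      by auto
    then show ?case
    proof cases
      case 1
      then show ?thesis
        by (intro exI[of _ "{}"]) auto
    next
      case 2
      then show ?thesis
        using Basis.prems by (intro exI[of _ "{x}"]) auto
    qed
  qed auto
qed

lemma pcv_finite:
  assumes "\<mu> \<in> point_continuous_valuations X" "openin X U" "0 \<le> r" "ennreal r < \<mu> U"
  shows "\<exists>F. finite F \<and> F \<subseteq> U \<and> (\<forall>V. openin X V \<and> F \<subseteq> V \<longrightarrow> ennreal r < \<mu> V)"
proof -
  have "openin (point_topology X) {U. openin X U \<and> ennreal r < \<mu> U}"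
    using assms by (simp add: point_continuous_valuations_def continuous_map_scott_ennreal_iff)
  from openin_point_topology_finite[OF this, of U] show ?thesis
    using assms by auto
qed

lemma pcv_mono:
  "\<lbrakk>\<mu> \<in> point_continuous_valuations X; openin X U; openin X V; U \<subseteq> V\<rbrakk> \<Longrightarrow> \<mu> U \<le> \<mu> V"
  by (auto simp: point_continuous_valuations_def valuation_def)

lemma pcv_modular:
  "\<lbrakk>\<mu> \<in> point_continuous_valuations X; openin X U; openin X V\<rbrakk> \<Longrightarrow>
    \<mu> U + \<mu> V = \<mu> (U \<union> V) + \<mu> (U \<inter> V)"
  by (auto simp: point_continuous_valuations_def valuation_def)

lemma pcv_empty: "\<mu> \<in> point_continuous_valuations X \<Longrightarrow> \<mu> {} = 0"
  by (auto simp: point_continuous_valuations_def valuation_def)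

text \<open>Intersecting with a set of finite measure makes the values on opens finite, so
  \<open>enn2real\<close> loses nothing there.\<close>

lemma finite_valuation_pcv:
  assumes \<mu>: "\<mu> \<in> point_continuous_valuations X" and W: "openin X W" and fin: "\<mu> W < \<infinity>"
  shows "finite_valuation X (\<lambda>V. enn2real (\<mu> (V \<inter> W)))"
proof -
  define m where "m V = enn2real (\<mu> (V \<inter> W))" for V
  have m: "ennreal (m V) = \<mu> (V \<inter> W)" if "openin X V" for V
    using pcv_mono[OF \<mu>, of "V \<inter> W" W] that W fin unfolding m_def
    by (intro ennreal_enn2real) (auto simp: infinity_ennreal_def intro: le_less_trans)
  have nonneg: "0 \<le> m V" for V
    by (simp add: m_def)
  have "finite_valuation X m"
  proof
    show "m {} = 0"
      using pcv_empty[OF \<mu>] by (simp add: m_def)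
    show "m U \<le> m V" if "openin X U" "openin X V" "U \<subseteq> V" for U V
    proof -
      have "ennreal (m U) \<le> ennreal (m V)"
        using that W by (simp add: m) (intro pcv_mono[OF \<mu>], auto)
      then show ?thesis
        using nonneg by simp
    qed
    show "m U + m V = m (U \<union> V) + m (U \<inter> V)" if "openin X U" "openin X V" for U V
    proof -
      have "U \<inter> W \<union> V \<inter> W = (U \<union> V) \<inter> W" "(U \<inter> W) \<inter> (V \<inter> W) = U \<inter> V \<inter> W"
        by auto
      then have "ennreal (m U) + ennreal (m V) = ennreal (m (U \<union> V)) + ennreal (m (U \<inter> V))"
        using pcv_modular[OF \<mu>, of "U \<inter> W" "V \<inter> W"] that W by (simp add: m openin_Un openin_Int)
      then show ?thesis
        using nonneg by (simp flip: ennreal_plus)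
    qed
    show "\<exists>F. finite F \<and> F \<subseteq> U \<and> (\<forall>V. openin X V \<and> F \<subseteq> V \<longrightarrow> m U - e \<le> m V)"
      if U: "openin X U" and "0 < e" for U e
    \<comment> \<open>\<open>pcv_finite\<close> requires a nonnegative threshold. Below zero,
      \<open>F = {}\<close> works because \<open>m\<close> is nonnegative.\<close>
    proof (cases "0 \<le> m U - e")
      case True
      then have "ennreal (m U - e) < \<mu> (U \<inter> W)"
        using \<open>0 < e\<close> by (simp add: ennreal_less_iff flip: m[OF U])
      then obtain F where F: "finite F" "F \<subseteq> U \<inter> W"
        "\<And>V. openin X V \<and> F \<subseteq> V \<Longrightarrow> ennreal (m U - e) < \<mu> V"
        using pcv_finite[OF \<mu>, of "U \<inter> W" "m U - e"] U W True by blast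
      have "m U - e \<le> m V" if V: "openin X V" "F \<subseteq> V" for V
      proof -
        have "ennreal (m U - e) < ennreal (m V)"
          using F(2) F(3)[of "V \<inter> W"] V W by (auto simp: m)
        then show ?thesis
          using True by (simp add: ennreal_less_iff)
      qed
      then show ?thesis
        using F by (intro exI[of _ F]) auto
    next
      case False
      then have "m U - e \<le> m V" for V
        using nonneg[of V] by linarith
      then show ?thesis
        by (intro exI[of _ "{}"]) auto
    qed
  qed
  then show ?thesis
    by (simp add: m_def[abs_def])
qed

text \<open>Capping \<open>\<mu>\<close> at \<open>r\<close> gives real values even where
  \<open>\<mu>\<close> is infinite. The result is still submodular, which is what the greedy
  algorithm asks for.\<close>

lemma pcv_approx_truncated:
  assumes \<mu>: "\<mu> \<in> point_continuous_valuations X" and U: "openin X U"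
    and r: "0 \<le> r" "ennreal r < \<mu> U"
  shows "\<exists>s. simple_mass X s \<and> (\<forall>V. openin X V \<longrightarrow> ennreal (s V) \<le> \<mu> V) \<and> r \<le> s U"
proof -
  obtain F where F: "finite F" "F \<subseteq> U" "\<And>V. openin X V \<and> F \<subseteq> V \<Longrightarrow> ennreal r < \<mu> V"
    using pcv_finite[OF \<mu> U r] by blast
  define m where "m V = enn2real (min (\<mu> V) (ennreal r))" for V
  have m: "ennreal (m V) = min (\<mu> V) (ennreal r)" for V
    unfolding m_def by (intro ennreal_enn2real) (simp add: min_less_iff_disj)
  have m_le: "m V \<le> r" for V
    using m[of V] r(1) by (metis ennreal_le_iff min.cobounded2)
  have nonneg: "0 \<le> m V" for V
    by (simp add: m_def)
  have m_mono: "m V \<le> m W" if "openin X V" "openin X W" "V \<subseteq> W" for V W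
  proof -
    have "ennreal (m V) \<le> ennreal (m W)"
      unfolding m using pcv_mono[OF \<mu> that] by (intro min.mono) auto
    then show ?thesis
      using nonneg by simp
  qed
  have "\<exists>s. simple_mass X s \<and> (\<forall>V. openin X V \<longrightarrow> s V \<le> m V) \<and> r \<le> s F"
  proof (rule submodular_on_opens_greedy)
    show "finite F" "F \<subseteq> topspace X"
      using F openin_subset[OF U] by auto
    show "m {} = 0"
      using pcv_empty[OF \<mu>] by (simp add: m_def)
    show "m V \<le> m W" if "openin X V" "openin X W" "V \<subseteq> W" for V W
      using m_mono that .
    show "m (V \<union> W) + m (V \<inter> W) \<le> m V + m W" if VW: "openin X V" "openin X W" for V W
    proof -
      have le: "m (V \<inter> W) \<le> m V" "m (V \<inter> W) \<le> m W"
        using VW by (auto intro: m_mono)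
      \<comment> \<open>If \<open>V\<close> or \<open>W\<close> reaches the cap, its value bounds
        that of the union, while the other set bounds the intersection. Otherwise neither is
        truncated and modularity of \<open>\<mu>\<close> applies.\<close>
      consider "ennreal r \<le> \<mu> V" | "ennreal r \<le> \<mu> W" | "\<mu> V < ennreal r" "\<mu> W < ennreal r"
        by force
      then show ?thesis
      proof cases
        case 1
        then have "m V = r"
          using r(1) by (simp add: m_def min_absorb2)
        then show ?thesis
          using le(2) m_le[of "V \<union> W"] by simp
      next
        case 2
        then have "m W = r"
          using r(1) by (simp add: m_def min_absorb2)
        then show ?thesis
          using le(1) m_le[of "V \<union> W"] by simp
      next
        case 3
        have "ennreal (m (V \<union> W)) + ennreal (m (V \<inter> W)) \<le> \<mu> (V \<union> W) + \<mu> (V \<inter> W)"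
          unfolding m by (intro add_mono) auto
        also have "\<dots> = \<mu> V + \<mu> W"
          using pcv_modular[OF \<mu> VW] by simp
        also have "\<dots> = ennreal (m V) + ennreal (m W)"
          unfolding m using 3 by (simp add: min_absorb1)
        finally show ?thesis
          using nonneg by (simp flip: ennreal_plus)
      qed
    qed
    show "r \<le> m V" if "openin X V" "F \<subseteq> V" for V
      using F(3)[of V] that r(1) by (simp add: m_def min_absorb2)
  qed
  then obtain s where s: "simple_mass X s" "\<And>V. openin X V \<Longrightarrow> s V \<le> m V" "r \<le> s F"
    by blast
  have "ennreal (s V) \<le> \<mu> V" if "openin X V" for V
    using ennreal_leI[OF s(2)[OF that]] unfolding m by simp
  moreover have "r \<le> s U"
    using s(3) simple_mass_mono[OF s(1) F(2)] by simp
  ultimately show ?thesis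
    using s(1) by blast
qed

text \<open>A finite union of sets of finite measure has finite measure, so \<open>\<mu>\<close> can
  be cut down to the union \<open>W\<close>; the strict inequalities leave room for a common
  error.\<close>

lemma pcv_approx_finite:
  assumes \<mu>: "\<mu> \<in> point_continuous_valuations X" and P: "finite P"
    "\<And>U r. (U, r) \<in> P \<Longrightarrow> openin X U \<and> 0 \<le> r \<and> ennreal r < \<mu> U \<and> \<mu> U < \<infinity>"
  shows "\<exists>s. simple_mass X s \<and> (\<forall>V. openin X V \<longrightarrow> ennreal (s V) \<le> \<mu> V) \<and>
    (\<forall>(U, r)\<in>P. r < s U)"
proof -
  define W where "W = \<Union>(fst ` P)"
  define m where "m V = enn2real (\<mu> (V \<inter> W))" for V
  have W: "openin X W"
    unfolding W_def using P by (intro openin_Union) auto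
  have W_fin: "\<mu> (\<Union>(fst ` Q)) < \<infinity>" if "Q \<subseteq> P" for Q
    using finite_subset[OF that P(1)] that
  proof (induction Q rule: finite_induct)
    case empty
    then show ?case
      using pcv_empty[OF \<mu>] by simp
  next
    case (insert p Q)
    obtain U r where p: "p = (U, r)"
      by force
    have "openin X U" "openin X (\<Union>(fst ` Q))"
      using insert.prems P(2) p by (auto intro!: openin_Union)
    from pcv_modular[OF \<mu> this]
    have "\<mu> (U \<union> \<Union>(fst ` Q)) \<le> \<mu> U + \<mu> (\<Union>(fst ` Q))"
      by simp
    also have "\<dots> < \<infinity>"
      using insert P(2)[of U r] p by (auto simp: infinity_ennreal_def)
    finally show ?case
      by (simp add: p)
  qed
  have "finite_valuation X m"
    unfolding m_def[abs_def] using \<mu> W W_fin[of P] by (intro finite_valuation_pcv) (auto simp: W_def)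
  have m: "ennreal (m V) = \<mu> (V \<inter> W)" if "openin X V" for V
    using pcv_mono[OF \<mu>, of "V \<inter> W" W] that W W_fin[of P] unfolding m_def W_def[symmetric]
    by (intro ennreal_enn2real) (auto simp: infinity_ennreal_def intro: le_less_trans)
  have gap: "0 < m U - r" if "(U, r) \<in> P" for U r
  proof -
    have "U \<inter> W = U"
      using that by (force simp: W_def)
    then have "ennreal r < ennreal (m U)"
      using P(2)[OF that] by (simp add: m)
    then show ?thesis
      using P(2)[OF that] by (simp add: ennreal_less_iff)
  qed
  \<comment> \<open>Only finitely many positive gaps matter, so every sufficiently small positive
    \<open>e\<close> fits below all of them.\<close>
  obtain e where e: "0 < e" "\<And>U r. (U, r) \<in> P \<Longrightarrow> e < m U - r"
  proof -
    have "\<forall>\<^sub>F e in at_right 0. e < m (fst p) - snd p" if "p \<in> P" for p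
      using gap[of "fst p" "snd p"] that by (intro eventually_at_rightI) auto
    then have "\<forall>\<^sub>F e in at_right 0. \<forall>p\<in>P. e < m (fst p) - snd p"
      using P(1) by (intro eventually_ball_finite) auto
    moreover have "\<forall>\<^sub>F e::real in at_right 0. 0 < e"
      by (simp add: eventually_at_right_less)
    ultimately have "\<forall>\<^sub>F e in at_right 0. 0 < e \<and> (\<forall>p\<in>P. e < m (fst p) - snd p)"
      by eventually_elim auto
    from eventually_happens'[OF trivial_limit_at_right_real this] show ?thesis
      by (elim exE conjE) (rule that, auto)
  qed
  \<comment> \<open>The index set is \<open>P\<close> itself, with \<open>fst\<close> as the family
    of sets.\<close>
  have "\<exists>s. simple_mass X s \<and> (\<forall>V. openin X V \<longrightarrow> s V \<le> m V) \<and> m W - e \<le> s W \<and>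
      (\<forall>p\<in>P. m (fst p) - e \<le> s (fst p))"
    by (rule finite_valuation_approx[OF P(1) \<open>finite_valuation X m\<close> W _ e(1)])
      (use P(2) in \<open>force simp: W_def\<close>)
  then obtain s where s: "simple_mass X s" "\<And>V. openin X V \<Longrightarrow> s V \<le> m V"
    "\<And>p. p \<in> P \<Longrightarrow> m (fst p) - e \<le> s (fst p)"
    by blast
  have "ennreal (s V) \<le> \<mu> V" if "openin X V" for V
  proof -
    have "ennreal (s V) \<le> \<mu> (V \<inter> W)"
      using ennreal_leI[OF s(2)[OF that]] m[OF that] by simp
    also have "\<dots> \<le> \<mu> V"
      using that W by (intro pcv_mono[OF \<mu>]) auto
    finally show ?thesis .
  qed
  moreover have "r < s U" if "(U, r) \<in> P" for U r
    using e(2)[OF that] s(3)[OF that] by simp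
  ultimately show ?thesis
    using s(1) by blast
qed

text \<open>Induction over the pairs of infinite measure, starting from a mass that serves the pairs
  of finite measure. Each new pair is met by mixing in a small share of a large dominated
  mass.\<close>

lemma pcv_approx:
  assumes \<mu>: "\<mu> \<in> point_continuous_valuations X" and P: "finite P"
    "\<And>U r. (U, r) \<in> P \<Longrightarrow> openin X U \<and> 0 \<le> r \<and> ennreal r < \<mu> U"
  shows "\<exists>s. simple_mass X s \<and> (\<forall>V. openin X V \<longrightarrow> ennreal (s V) \<le> \<mu> V) \<and>
    (\<forall>(U, r)\<in>P. r < s U)"
proof -
  define A where "A = {(U, r) \<in> P. \<mu> U < \<infinity>}"
  define B where "B = {(U, r) \<in> P. \<mu> U = \<infinity>}"
  have "A \<subseteq> P" "B \<subseteq> P" "P = B \<union> A"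
    by (auto simp: A_def B_def infinity_ennreal_def simp flip: less_top)
  have "finite A" "finite B"
    using \<open>A \<subseteq> P\<close> \<open>B \<subseteq> P\<close> P(1) finite_subset by blast+
  have B: "openin X U \<and> 0 \<le> r \<and> \<mu> U = \<infinity>" if "(U, r) \<in> B" for U r
    using that P(2) by (auto simp: B_def)
  from \<open>finite B\<close> B have "\<exists>s. simple_mass X s \<and> (\<forall>V. openin X V \<longrightarrow> ennreal (s V) \<le> \<mu> V) \<and>
    (\<forall>(U, r)\<in>B \<union> A. r < s U)"
  proof (induction B rule: finite_induct)
    case empty
    show ?case
      using pcv_approx_finite[OF \<mu> \<open>finite A\<close>] P(2) by (auto simp: A_def)
  next
    case (insert p B)
    obtain U r where p: "p = (U, r)"
      by force
    have U: "openin X U" "0 \<le> r" "\<mu> U = \<infinity>"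
      using insert.prems p by auto
    obtain s where s: "simple_mass X s" "\<And>V. openin X V \<Longrightarrow> ennreal (s V) \<le> \<mu> V"
      "\<And>q. q \<in> B \<union> A \<Longrightarrow> snd q < s (fst q)"
      using insert.IH insert.prems by fastforce
    \<comment> \<open>The earlier inequalities are strict and finite in number, so they survive
      scaling by \<open>1 - \<eta>\<close> for small \<open>\<eta>\<close>.\<close>
    obtain \<eta> where \<eta>: "0 < \<eta>" "\<eta> < 1" "\<And>q. q \<in> B \<union> A \<Longrightarrow> snd q < (1 - \<eta>) * s (fst q)"
    proof -
      have "\<forall>\<^sub>F \<eta> in at_right 0. snd q < (1 - \<eta>) * s (fst q)" if "q \<in> B \<union> A" for q
      proof -
        have "((\<lambda>\<eta>. (1 - \<eta>) * s (fst q)) \<longlongrightarrow> (1 - 0) * s (fst q)) (at_right 0)"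
          by (intro tendsto_intros)
        then show ?thesis
          using s(3)[OF that] by (intro order_tendstoD(1)) auto
      qed
      then have "\<forall>\<^sub>F \<eta> in at_right 0. \<forall>q\<in>B \<union> A. snd q < (1 - \<eta>) * s (fst q)"
        using \<open>finite A\<close> \<open>finite B\<close> by (intro eventually_ball_finite) auto
      moreover have "\<forall>\<^sub>F \<eta>::real in at_right 0. 0 < \<eta> \<and> \<eta> < 1"
        by (rule eventually_at_rightI[of 0 1]) auto
      ultimately have "\<forall>\<^sub>F \<eta> in at_right 0. (0 < \<eta> \<and> \<eta> < 1) \<and>
          (\<forall>q\<in>B \<union> A. snd q < (1 - \<eta>) * s (fst q))"
        by eventually_elim auto
      from eventually_happens'[OF trivial_limit_at_right_real this] show ?thesis
        by (elim exE conjE) (rule that, auto)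
    qed
    \<comment> \<open>Chosen so that \<open>\<eta> * R = r + 1\<close>; such a mass is available
      because \<open>\<mu> U\<close> is infinite.\<close>
    define R where "R = (r + 1) / \<eta>"
    have "0 \<le> R" "ennreal R < \<mu> U"
      using U \<eta> by (auto simp: R_def)
    from pcv_approx_truncated[OF \<mu> U(1) this]
    obtain t where t: "simple_mass X t" "\<And>V. openin X V \<Longrightarrow> ennreal (t V) \<le> \<mu> V" "R \<le> t U"
      by blast
    define u where "u V = (1 - \<eta>) * s V + \<eta> * t V" for V
    have u: "simple_mass X u"
      unfolding u_def using s(1) t(1) \<eta> by (intro simple_mass_add simple_mass_scale) auto
    have nonneg: "0 \<le> s V" "0 \<le> t V" for V
      using s(1) t(1) by (auto simp: simple_mass_nonneg)
    \<comment> \<open>A convex combination is at most the larger of \<open>s V\<close> and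
      \<open>t V\<close>, and both lie below \<open>\<mu> V\<close>.\<close>
    have "ennreal (u V) \<le> \<mu> V" if "openin X V" for V
    proof (cases "s V \<le> t V")
      case True
      then have "u V \<le> t V"
        using \<eta> mult_left_mono[of "s V" "t V" "1 - \<eta>"] by (simp add: u_def algebra_simps)
      then show ?thesis
        using t(2)[OF that] by (meson ennreal_leI order_trans)
    next
      case False
      then have "u V \<le> s V"
        using \<eta> mult_left_mono[of "t V" "s V" "\<eta>"] by (simp add: u_def algebra_simps)
      then show ?thesis
        using s(2)[OF that] by (meson ennreal_leI order_trans)
    qed
    moreover have "r < u U"
    proof -
      have "r < \<eta> * R"
        using \<eta> by (simp add: R_def)
      also have "\<dots> \<le> \<eta> * t U"
        using t(3) \<eta> by simp
      also have "\<dots> \<le> u U"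
        using \<eta> nonneg by (simp add: u_def)
      finally show ?thesis .
    qed
    moreover have "snd q < u (fst q)" if "q \<in> B \<union> A" for q
    proof -
      have "0 \<le> \<eta> * t (fst q)"
        using \<eta> nonneg by simp
      then show ?thesis
        using \<eta>(3)[OF that] by (simp add: u_def)
    qed
    ultimately show ?case
      using u by (intro exI[of _ u]) (auto simp: p)
  qed
  then show ?thesis
    using \<open>P = B \<union> A\<close> by simp
qed

section \<open>Continuous linear maps on the cone of valuations\<close>

lemma openin_Vp_finite:
  assumes "openin (Vp X) A" "\<mu> \<in> A"
  shows "\<exists>P. finite P \<and> (\<forall>(U, r)\<in>P. openin X U \<and> 0 \<le> r \<and> ennreal r < \<mu> U) \<and>
    (\<forall>\<nu>\<in>point_continuous_valuations X. (\<forall>(U, r)\<in>P. ennreal r < \<nu> U) \<longrightarrow> \<nu> \<in> A)"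
proof -
  have "generate_topology_on (insert (point_continuous_valuations X)
      {{\<mu> \<in> point_continuous_valuations X. ennreal r < \<mu> U} | U r. openin X U \<and> 0 \<le> r}) A"
    using assms(1) by (simp add: Vp_def openin_topology_generated_by_iff)
  then show ?thesis
    using assms(2)
  proof induction
    case (Int A B)
    from Int.IH(1)[OF IntD1[OF Int.prems]] obtain P where P:
      "finite P" "\<forall>(U, r)\<in>P. openin X U \<and> 0 \<le> r \<and> ennreal r < \<mu> U"
      "\<forall>\<nu>\<in>point_continuous_valuations X. (\<forall>(U, r)\<in>P. ennreal r < \<nu> U) \<longrightarrow> \<nu> \<in> A"
      by (elim exE conjE)
    from Int.IH(2)[OF IntD2[OF Int.prems]] obtain Q where Q:
      "finite Q" "\<forall>(U, r)\<in>Q. openin X U \<and> 0 \<le> r \<and> ennreal r < \<mu> U"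
      "\<forall>\<nu>\<in>point_continuous_valuations X. (\<forall>(U, r)\<in>Q. ennreal r < \<nu> U) \<longrightarrow> \<nu> \<in> B"
      by (elim exE conjE)
    show ?case
    proof (intro exI[of _ "P \<union> Q"] conjI)
      show "finite (P \<union> Q)"
        using P(1) Q(1) by simp
      show "\<forall>(U, r)\<in>P \<union> Q. openin X U \<and> 0 \<le> r \<and> ennreal r < \<mu> U"
        using P(2) Q(2) by (simp only: ball_Un)
      show "\<forall>\<nu>\<in>point_continuous_valuations X. (\<forall>(U, r)\<in>P \<union> Q. ennreal r < \<nu> U) \<longrightarrow> \<nu> \<in> A \<inter> B"
        using P(3) Q(3) by (simp only: ball_Un Int_iff) blast
    qed
  next
    case (UN K)
    from UN.prems obtain B where "B \<in> K" "\<mu> \<in> B"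
      by blast
    from UN.IH[OF this] obtain P where
      "finite P" "\<forall>(U, r)\<in>P. openin X U \<and> 0 \<le> r \<and> ennreal r < \<mu> U"
      "\<forall>\<nu>\<in>point_continuous_valuations X. (\<forall>(U, r)\<in>P. ennreal r < \<nu> U) \<longrightarrow> \<nu> \<in> B"
      by (elim exE conjE)
    then show ?case
      using subsetD[OF Union_upper[OF \<open>B \<in> K\<close>]] by (intro exI[of _ P]) simp
  next
    case (Basis A)
    then consider "A = point_continuous_valuations X"
      | U r where "A = {\<mu> \<in> point_continuous_valuations X. ennreal r < \<mu> U}" "openin X U" "0 \<le> r"
      by auto
    then show ?case
    proof cases
      case 1
      then show ?thesis
        by (intro exI[of _ "{}"]) auto
    next
      case 2
      then show ?thesis
        using Basis.prems by (intro exI[of _ "{(U, r)}"]) auto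
    qed
  qed auto
qed

text \<open>Basic neighbourhoods only bound values from below, and such bounds survive enlarging the
  valuation.\<close>

lemma openin_Vp_upward:
  assumes "openin (Vp X) A" "\<nu> \<in> A" "\<mu> \<in> point_continuous_valuations X"
    and "\<And>U. openin X U \<Longrightarrow> \<nu> U \<le> \<mu> U"
  shows "\<mu> \<in> A"
proof -
  obtain P where P: "\<forall>(U, r)\<in>P. openin X U \<and> 0 \<le> r \<and> ennreal r < \<nu> U"
    "\<forall>\<mu>\<in>point_continuous_valuations X. (\<forall>(U, r)\<in>P. ennreal r < \<mu> U) \<longrightarrow> \<mu> \<in> A"
    using openin_Vp_finite[OF assms(1,2)] by blast
  have "\<forall>(U, r)\<in>P. ennreal r < \<mu> U"
    using P(1) assms(4) less_le_trans by fast
  then show ?thesis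
    using P(2) assms(3) by blast
qed

section \<open>Simple valuations and the uniqueness of continuous linear extensions\<close>

definition simple_valuation :: "'a topology \<Rightarrow> ('a set \<Rightarrow> real) \<Rightarrow> 'a set \<Rightarrow> ennreal" where
  "simple_valuation X s = (\<lambda>U\<in>Collect (openin X). ennreal (s U))"

lemma simple_valuation_zero: "simple_valuation X (\<lambda>U. 0) = \<zero>\<^bsub>Vp_cone X\<^esub>"
  by (simp add: simple_valuation_def Vp_cone_def)

text \<open>The factor \<open>1\<close> gives the sum the exact shape to which
  \<open>cone_linear\<close> applies.\<close>

lemma simple_valuation_add_point:
  assumes "0 \<le> r" "\<And>U. 0 \<le> s U"
  shows "simple_valuation X (\<lambda>U. r * indicator U x + s U) =
    r \<odot>\<^bsub>Vp_cone X\<^esub> dirac X x \<oplus>\<^bsub>Vp_cone X\<^esub> 1 \<odot>\<^bsub>Vp_cone X\<^esub> simple_valuation X s"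
  using assms
  by (auto simp: simple_valuation_def Vp_cone_def dirac_def indicator_def fun_eq_iff)

lemma carrier_Vp_cone [simp]: "carrier (Vp_cone X) = point_continuous_valuations X"
  by (simp add: Vp_cone_def)

lemma simple_valuation_pcv:
  assumes "simple_mass X s"
  shows "simple_valuation X s \<in> point_continuous_valuations X"
  using assms
proof (induction rule: simple_mass.induct)
  case zero
  interpret cone "Vp_cone X"
    by (rule cone_Vp_cone)
  show ?case
    using zero_closed by (simp add: simple_valuation_zero)
next
  case (add_point s x r)
  interpret cone "Vp_cone X"
    by (rule cone_Vp_cone)
  show ?case
    using add_point a_closed scale_closed dirac_in_Vp[of x X]
    by (simp add: simple_valuation_add_point simple_mass_nonneg)
qed

lemma cone_linear_zero:
  assumes "cone C" "cone D" "cone_linear C D g"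
  shows "g \<zero>\<^bsub>C\<^esub> = \<zero>\<^bsub>D\<^esub>"
proof -
  interpret C: cone C
    by fact
  interpret D: cone D
    by fact
  have "g (0 \<odot>\<^bsub>C\<^esub> \<zero>\<^bsub>C\<^esub> \<oplus>\<^bsub>C\<^esub> 0 \<odot>\<^bsub>C\<^esub> \<zero>\<^bsub>C\<^esub>) = 0 \<odot>\<^bsub>D\<^esub> g \<zero>\<^bsub>C\<^esub> \<oplus>\<^bsub>D\<^esub> 0 \<odot>\<^bsub>D\<^esub> g \<zero>\<^bsub>C\<^esub>"
    using assms(3) C.zero_closed by (simp add: cone_linear_def)
  moreover have "g \<zero>\<^bsub>C\<^esub> \<in> carrier D"
    using assms(3) C.zero_closed by (auto simp: cone_linear_def)
  ultimately show ?thesis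
    by (simp add: C.scale_zero_right D.scale_zero_left)
qed

lemma cone_linear_simple_mass_eq:
  assumes "cone C" "cone_linear (Vp_cone X) C g" "cone_linear (Vp_cone X) C h"
    and "\<And>x. x \<in> topspace X \<Longrightarrow> g (dirac X x) = h (dirac X x)" "simple_mass X s"
  shows "g (simple_valuation X s) = h (simple_valuation X s)"
  using assms(5)
proof (induction rule: simple_mass.induct)
  case zero
  show ?case
    using cone_linear_zero[OF cone_Vp_cone assms(1,2)] cone_linear_zero[OF cone_Vp_cone assms(1,3)]
    by (simp add: simple_valuation_zero)
next
  case (add_point s x r)
  have "k (r \<odot>\<^bsub>Vp_cone X\<^esub> dirac X x \<oplus>\<^bsub>Vp_cone X\<^esub> 1 \<odot>\<^bsub>Vp_cone X\<^esub> simple_valuation X s) =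
      r \<odot>\<^bsub>C\<^esub> k (dirac X x) \<oplus>\<^bsub>C\<^esub> 1 \<odot>\<^bsub>C\<^esub> k (simple_valuation X s)" if "cone_linear (Vp_cone X) C k" for k
    using that add_point.hyps dirac_in_Vp[of x X] simple_valuation_pcv[of X s]
    by (simp add: cone_linear_def)
  from this[OF assms(2)] this[OF assms(3)] show ?case
    using assms(4) add_point by (simp add: simple_valuation_add_point simple_mass_nonneg)
qed

text \<open>The maps agree on simple valuations, and those below \<open>\<mu>\<close> suffice to
  show that \<open>g \<mu>\<close> and \<open>h \<mu>\<close> lie in the same open sets.\<close>

lemma cone_linear_eq_on_dirac:
  assumes "cone C" "t0_space T"
    and g: "continuous_map (Vp X) T g" "cone_linear (Vp_cone X) C g"
    and h: "continuous_map (Vp X) T h" "cone_linear (Vp_cone X) C h"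
    and dirac: "\<And>x. x \<in> topspace X \<Longrightarrow> g (dirac X x) = h (dirac X x)"
    and \<mu>: "\<mu> \<in> point_continuous_valuations X"
  shows "g \<mu> = h \<mu>"
proof -
  \<comment> \<open>Stated for an arbitrary pair of maps, so that exchanging \<open>g\<close> and
    \<open>h\<close> gives the converse.\<close>
  have *: "k' \<mu> \<in> V"
    if k: "continuous_map (Vp X) T k" "cone_linear (Vp_cone X) C k"
      and k': "continuous_map (Vp X) T k'" "cone_linear (Vp_cone X) C k'"
      and eq: "\<And>x. x \<in> topspace X \<Longrightarrow> k (dirac X x) = k' (dirac X x)"
      and V: "openin T V" "k \<mu> \<in> V" for k k' V
  proof -
    have "\<mu> \<in> {\<nu> \<in> topspace (Vp X). k \<nu> \<in> V}"
      using \<mu> V by simp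
    from openin_Vp_finite[OF openin_continuous_map_preimage[OF k(1) V(1)] this]
    obtain P where P: "finite P"
      "\<forall>(U, r)\<in>P. openin X U \<and> 0 \<le> r \<and> ennreal r < \<mu> U"
      "\<forall>\<nu>\<in>point_continuous_valuations X. (\<forall>(U, r)\<in>P. ennreal r < \<nu> U) \<longrightarrow>
        \<nu> \<in> {\<nu> \<in> topspace (Vp X). k \<nu> \<in> V}"
      by (elim exE conjE)
    obtain s where s: "simple_mass X s" "\<And>V. openin X V \<Longrightarrow> ennreal (s V) \<le> \<mu> V"
      "\<forall>(U, r)\<in>P. r < s U"
      using pcv_approx[OF \<mu> P(1)] P(2) by blast
    let ?\<sigma> = "simple_valuation X s"
    have \<sigma>: "?\<sigma> \<in> point_continuous_valuations X"
      using simple_valuation_pcv[OF s(1)] .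
    have "\<forall>(U, r)\<in>P. ennreal r < ?\<sigma> U"
      using P(2) s(3) by (fastforce simp: simple_valuation_def ennreal_less_iff)
    then have "k ?\<sigma> \<in> V"
      using P(3) \<sigma> by blast
    then have "k' ?\<sigma> \<in> V"
      using cone_linear_simple_mass_eq[OF \<open>cone C\<close> k(2) k'(2) eq s(1)] by simp
    \<comment> \<open>The preimage of \<open>V\<close> under \<open>k'\<close> is open, hence
      upwards closed, which leads from \<open>?\<sigma>\<close> up to \<open>\<mu>\<close>.\<close>
    then have "\<mu> \<in> {\<nu> \<in> topspace (Vp X). k' \<nu> \<in> V}"
      using \<sigma> \<mu> s(2)
      by - (rule openin_Vp_upward[OF openin_continuous_map_preimage[OF k'(1) V(1)], of ?\<sigma>],
        auto simp: simple_valuation_def)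
    then show ?thesis
      by simp
  qed
  have "g \<mu> \<in> V \<longleftrightarrow> h \<mu> \<in> V" if "openin T V" for V
    using *[OF g h dirac that] *[OF h g dirac[symmetric] that] by blast
  moreover have "g \<mu> \<in> topspace T" "h \<mu> \<in> topspace T"
    using g(1) h(1) \<mu> by (auto simp: continuous_map_def Pi_iff)
  ultimately show ?thesis
    using \<open>t0_space T\<close> unfolding t0_space_def by metis
qed

section \<open>Functoriality\<close>

text \<open>On opens the pushforward is \<open>\<mu>\<close> composed with the preimage map, which
  is continuous for the point topologies: the preimage of \<open>V\<close> contains \<open>x\<close>
  exactly when \<open>V\<close> contains \<open>f x\<close>.\<close>

lemma Vp_map_pcv:
  assumes f: "continuous_map X Y f" and \<mu>: "\<mu> \<in> point_continuous_valuations X"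
  shows "Vp_map X Y f \<mu> \<in> point_continuous_valuations Y"
proof -
  let ?p = "\<lambda>V. {x \<in> topspace X. f x \<in> V}"
  have p: "openin X (?p V)" if "openin Y V" for V
    using openin_continuous_map_preimage[OF f that] .
  have "continuous_map (point_topology Y) (point_topology X) ?p"
    unfolding point_topology_def[of X]
  proof (rule continuous_on_generated_topo)
    fix A
    assume "A \<in> insert (Collect (openin X)) {{U. openin X U \<and> x \<in> U} |x. x \<in> topspace X}"
    then consider "A = Collect (openin X)" | x where "x \<in> topspace X" "A = {U. openin X U \<and> x \<in> U}"
      by auto
    then show "openin (point_topology Y) (?p -` A \<inter> topspace (point_topology Y))"
    proof cases
      case 1
      then have "?p -` A \<inter> topspace (point_topology Y) = topspace (point_topology Y)"
        using p by auto
      then show ?thesis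
        by (metis openin_topspace)
    next
      case 2
      then have "?p -` A \<inter> topspace (point_topology Y) = {V. openin Y V \<and> f x \<in> V}"
        using p by auto
      moreover have "f x \<in> topspace Y"
        using f 2 by (auto simp: continuous_map_def)
      ultimately show ?thesis
        by (auto simp: point_topology_def intro!: topology_generated_by_Basis)
    qed
  next
    show "?p ` topspace (point_topology Y) \<subseteq>
        \<Union>(insert (Collect (openin X)) {{U. openin X U \<and> x \<in> U} |x. x \<in> topspace X})"
      using p by auto
  qed
  moreover have "continuous_map (point_topology X) scott_ennreal \<mu>"
    using \<mu> by (simp add: point_continuous_valuations_def)
  ultimately have "continuous_map (point_topology Y) scott_ennreal (\<mu> \<circ> ?p)"
    by (rule continuous_map_compose)
  then have "continuous_map (point_topology Y) scott_ennreal (Vp_map X Y f \<mu>)"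
    by (rule continuous_map_eq) (simp add: Vp_map_def)
  moreover have "valuation Y (Vp_map X Y f \<mu>)"
    unfolding valuation_def
  proof (intro conjI allI impI)
    show "Vp_map X Y f \<mu> {} = 0"
      using pcv_empty[OF \<mu>] by (simp add: Vp_map_def)
    show "Vp_map X Y f \<mu> U \<le> Vp_map X Y f \<mu> V" if "openin Y U \<and> openin Y V \<and> U \<subseteq> V" for U V
      using that p by (auto simp: Vp_map_def intro!: pcv_mono[OF \<mu>])
    show "Vp_map X Y f \<mu> U + Vp_map X Y f \<mu> V = Vp_map X Y f \<mu> (U \<union> V) + Vp_map X Y f \<mu> (U \<inter> V)"
      if "openin Y U \<and> openin Y V" for U V
    proof -
      have "?p U \<union> ?p V = ?p (U \<union> V)" "?p U \<inter> ?p V = ?p (U \<inter> V)"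
        by auto
      then show ?thesis
        using that pcv_modular[OF \<mu> p p, of U V] by (simp add: Vp_map_def openin_Un openin_Int)
    qed
  qed
  ultimately show ?thesis
    by (simp add: point_continuous_valuations_def Vp_map_def)
qed

lemma continuous_map_Vp_map:
  assumes f: "continuous_map X Y f"
  shows "continuous_map (Vp X) (Vp Y) (Vp_map X Y f)"
  unfolding Vp_def[of Y]
proof (rule continuous_on_generated_topo)
  fix A
  assume "A \<in> insert (point_continuous_valuations Y)
    {{\<mu> \<in> point_continuous_valuations Y. ennreal r < \<mu> U} |U r. openin Y U \<and> 0 \<le> r}"
  then consider "A = point_continuous_valuations Y"
    | U r where "A = {\<mu> \<in> point_continuous_valuations Y. ennreal r < \<mu> U}" "openin Y U" "0 \<le> r"
    by auto
  then show "openin (Vp X) (Vp_map X Y f -` A \<inter> topspace (Vp X))"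
  proof cases
    case 1
    then have "Vp_map X Y f -` A \<inter> topspace (Vp X) = topspace (Vp X)"
      using Vp_map_pcv[OF f] by auto
    then show ?thesis
      by (metis openin_topspace)
  next
    case 2
    then have "Vp_map X Y f -` A \<inter> topspace (Vp X) =
        {\<mu> \<in> point_continuous_valuations X. ennreal r < \<mu> {x \<in> topspace X. f x \<in> U}}"
      using Vp_map_pcv[OF f] by (auto simp: Vp_map_def)
    then show ?thesis
      using openin_continuous_map_preimage[OF f 2(2)] 2(3)
      by (auto simp: Vp_def intro!: topology_generated_by_Basis)
  qed
next
  show "Vp_map X Y f ` topspace (Vp X) \<subseteq> \<Union>(insert (point_continuous_valuations Y)
      {{\<mu> \<in> point_continuous_valuations Y. ennreal r < \<mu> U} |U r. openin Y U \<and> 0 \<le> r})"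
    using Vp_map_pcv[OF f] by auto
qed

lemma cone_linear_Vp_map:
  assumes f: "continuous_map X Y f"
  shows "cone_linear (Vp_cone X) (Vp_cone Y) (Vp_map X Y f)"
  using Vp_map_pcv[OF f] openin_continuous_map_preimage[OF f]
  by (auto simp: cone_linear_def Vp_map_def Vp_cone_def fun_eq_iff)

lemma Vp_map_dirac:
  assumes "continuous_map X Y f" "x \<in> topspace X"
  shows "Vp_map X Y f (dirac X x) = dirac Y (f x)"
  using assms openin_continuous_map_preimage[OF assms(1)]
  by (auto simp: Vp_map_def dirac_def fun_eq_iff)

lemma cone_linear_compose:
  assumes "cone_linear C D g" "cone_linear D E h"
  shows "cone_linear C E (h \<circ> g)"
  using assms unfolding cone_linear_def by (simp add: Pi_iff)

section \<open>Algebra morphisms versus linear maps\<close>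

theorem theorem5p12:
  fixes X :: "(real, 'a) module" and TX :: "'a topology"
    and Y :: "(real, 'b) module" and TY :: "'b topology"
    and \<alpha> :: "('a set \<Rightarrow> ennreal) \<Rightarrow> 'a" and \<beta> :: "('b set \<Rightarrow> ennreal) \<Rightarrow> 'b"
    and f :: "'a \<Rightarrow> 'b"
  assumes "topological_cone X TX" and "weakly_locally_convex X TX" and "sober_space TX"
    and "topological_cone Y TY" and "weakly_locally_convex Y TY" and "sober_space TY"
    and "Vp_structure_map X TX \<alpha>" and "Vp_structure_map Y TY \<beta>"
    and "continuous_map TX TY f"
  shows "Vp_algebra_morphism TX \<alpha> TY \<beta> f \<longleftrightarrow> cone_linear X Y f"
proof -
  interpret X: topological_cone X TX
    by fact
  interpret Y: topological_cone Y TY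
    by fact
  have \<alpha>: "continuous_map (Vp TX) TX \<alpha>" "cone_linear (Vp_cone TX) X \<alpha>"
    "\<And>x. x \<in> topspace TX \<Longrightarrow> \<alpha> (dirac TX x) = x"
    and \<beta>: "continuous_map (Vp TY) TY \<beta>" "cone_linear (Vp_cone TY) Y \<beta>"
    "\<And>y. y \<in> topspace TY \<Longrightarrow> \<beta> (dirac TY y) = y"
    using assms(7,8) by (auto simp: Vp_structure_map_def)
  note f = \<open>continuous_map TX TY f\<close>
  have f_closed: "f x \<in> topspace TY" if "x \<in> topspace TX" for x
    using f that by (auto simp: continuous_map_def)
  \<comment> \<open>Pushing forward is linear for every continuous \<open>f\<close>, so this
    composite is linear before anything is known about linearity of \<open>f\<close>.\<close>
  have \<beta>f: "continuous_map (Vp TX) TY (\<beta> \<circ> Vp_map TX TY f)"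
    "cone_linear (Vp_cone TX) Y (\<beta> \<circ> Vp_map TX TY f)"
    using continuous_map_compose[OF continuous_map_Vp_map[OF f] \<beta>(1)]
      cone_linear_compose[OF cone_linear_Vp_map[OF f] \<beta>(2)] by auto
  have \<beta>f_dirac: "(\<beta> \<circ> Vp_map TX TY f) (dirac TX x) = f x" if "x \<in> topspace TX" for x
    using that f_closed f by (simp add: Vp_map_dirac \<beta>(3))
  show ?thesis
  proof
    assume morphism: "Vp_algebra_morphism TX \<alpha> TY \<beta> f"
    interpret V: cone "Vp_cone TX"
      by (rule cone_Vp_cone)
    show "cone_linear X Y f"
      unfolding cone_linear_def
    proof (intro conjI allI impI ballI)
      show "f \<in> carrier X \<rightarrow> carrier Y"
        using f_closed by (simp add: X.topspace_eq Y.topspace_eq)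
      fix r s :: real and x y
      assume rs: "0 \<le> r" "0 \<le> s" and "x \<in> carrier X" "y \<in> carrier X"
      then have xy: "x \<in> topspace TX" "y \<in> topspace TX"
        by (simp_all add: X.topspace_eq)
      \<comment> \<open>Evaluating the morphism equation at a combination of two Dirac masses yields
        the linearity equation: \<open>\<alpha>\<close> and
        \<open>\<beta> \<circ> Vp_map TX TY f\<close> turn it into the two combinations to be
        compared.\<close>
      define \<mu> where "\<mu> = r \<odot>\<^bsub>Vp_cone TX\<^esub> dirac TX x \<oplus>\<^bsub>Vp_cone TX\<^esub> s \<odot>\<^bsub>Vp_cone TX\<^esub> dirac TX y"
      have D: "dirac TX x \<in> carrier (Vp_cone TX)" "dirac TX y \<in> carrier (Vp_cone TX)"
        using xy by (simp_all add: dirac_in_Vp)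
      then have "\<mu> \<in> topspace (Vp TX)"
        using rs V.scale_closed V.a_closed by (simp add: \<mu>_def)
      then have "f (\<alpha> \<mu>) = (\<beta> \<circ> Vp_map TX TY f) \<mu>"
        using morphism by (simp add: Vp_algebra_morphism_def)
      moreover have "\<alpha> \<mu> = r \<odot>\<^bsub>X\<^esub> x \<oplus>\<^bsub>X\<^esub> s \<odot>\<^bsub>X\<^esub> y"
        using \<alpha>(2) rs D xy unfolding \<mu>_def cone_linear_def by (simp add: \<alpha>(3))
      moreover have "(\<beta> \<circ> Vp_map TX TY f) \<mu> = r \<odot>\<^bsub>Y\<^esub> f x \<oplus>\<^bsub>Y\<^esub> s \<odot>\<^bsub>Y\<^esub> f y"
        using \<beta>f(2) rs D \<beta>f_dirac[OF xy(1)] \<beta>f_dirac[OF xy(2)]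
        unfolding \<mu>_def cone_linear_def by simp
      ultimately show "f (r \<odot>\<^bsub>X\<^esub> x \<oplus>\<^bsub>X\<^esub> s \<odot>\<^bsub>X\<^esub> y) = r \<odot>\<^bsub>Y\<^esub> f x \<oplus>\<^bsub>Y\<^esub> s \<odot>\<^bsub>Y\<^esub> f y"
        by simp
    qed
  next
    assume linear: "cone_linear X Y f"
    \<comment> \<open>Linearity of \<open>f\<close> makes \<open>f \<circ> \<alpha>\<close> linear,
      and both composites send \<open>dirac TX x\<close> to \<open>f x\<close>.\<close>
    have "(\<beta> \<circ> Vp_map TX TY f) \<mu> = (f \<circ> \<alpha>) \<mu>" if "\<mu> \<in> topspace (Vp TX)" for \<mu>
    proof (rule cone_linear_eq_on_dirac[OF _ Y.t0 \<beta>f])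
      show "cone Y"
        by unfold_locales
      show "continuous_map (Vp TX) TY (f \<circ> \<alpha>)"
        using \<alpha>(1) f by (rule continuous_map_compose)
      show "cone_linear (Vp_cone TX) Y (f \<circ> \<alpha>)"
        using \<alpha>(2) linear by (rule cone_linear_compose)
      show "(\<beta> \<circ> Vp_map TX TY f) (dirac TX x) = (f \<circ> \<alpha>) (dirac TX x)"
        if "x \<in> topspace TX" for x
        using \<beta>f_dirac[OF that] \<alpha>(3)[OF that] by simp
    qed (use that in auto)
    then show "Vp_algebra_morphism TX \<alpha> TY \<beta> f"
      using f by (simp add: Vp_algebra_morphism_def)
  qed
qed

end
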